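(* The set $B_0=\{\Gamma\in\mathcal{VS}\mid\Gamma^{(0)}=\Gamma\}$ of virtual strings fixed by the $0$-covering map is infinite.
   Context: Nanowords. A Gauss word is a finite word (possibly empty) in which each letter appears exactly twice or not at all. A nanoword is a Gauss word together with a map $X\mapsto|X|\in\{a,b\}$ from its letters to $\{a,b\}$ ($|X|$ is the type of $X$). An isomorphism of nanowords is a type-preserving relabelling of letters which carries the $k$th letter of one word to the $k$th letter of the other for all $k$. Two nanowords are homotopic if related by a finite sequence of isomorphisms and the following moves and their inverses ($x,y,z,t$ are arbitrary sequences of letters such that both sides are Gauss words, types of letters being unchanged unless stated): shift: $AxAy\leftrightarrow xA'yA'$ where $|A'|\neq|A|$; H1: $xAAy\leftrightarrow xy$; H2: $xAByBAz\leftrightarrow xyz$ where $|A|\ne|B|$; H3: $xAByACzBCt\leftrightarrow xBAyCAzCBt$ where $|A|=|B|=|C|$. Virtual strings. A virtual string is (equivalently to its definition via planar diagrams with real and virtual crossings modulo flattened Reidemeister-type moves) a homotopy class of nanowords; $\mathcal{VS}$ is the set of all of them. A nanoword represents its class. Linking. Let $\alpha$ be a nanoword. Distinct letters $A,B$ are linked if they alternate in $\alpha$. Set $l(A,B)=0$ if $A=B$ or $A,B$ are not linked. If they occur in the order $\dots A\dots B\dots A\dots B\dots$, set $l(A,B)=1$ if $|A|=|B|$ and $-1$ otherwise; if in the order $\dots B\dots A\dots B\dots A\dots$, set $l(A,B)=-1$ if $|A|=|B|$ and $1$ otherwise. Put $n(X)=\sum_{Y\in\alpha}l(X,Y)$,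 the sum over all letters $Y$ of $\alpha$. Coverings. The $0$-covering $\alpha^{(0)}$ of $\alpha$ is obtained by deleting from $\alpha$ (both occurrences of) every letter $X$ for which $n(X)$ (computed in $\alpha$) is non-zero. It is known that homotopic nanowords have homotopic $0$-coverings, so for a virtual string $\Gamma$ represented by $\alpha$, $\Gamma^{(0)}$ is defined as the virtual string represented by $\alpha^{(0)}$. *)

theory Defs
  imports Main
begin

definition gauss_word :: "'a list \<Rightarrow> bool" where
  "gauss_word w \<longleftrightarrow> (\<forall>X \<in> set w. count_list w X = 2)"

datatype letter_type = Type_a | Type_b

text \<open>
  Letters are drawn from the countably infinite alphabet \<^typ>\<open>nat\<close>.  The type map is a total function
  of which only the values on the letters of the word are meaningful; nanowords that differ in the
  other values are isomorphic via the identity relabelling.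
\<close>
type_synonym nanoword = "nat list \<times> (nat \<Rightarrow> letter_type)"

definition nanowords :: "nanoword set" where
  "nanowords = {(w, t). gauss_word w}"

definition isomorphic :: "nanoword \<Rightarrow> nanoword \<Rightarrow> bool" where
  "isomorphic \<alpha> \<beta> \<longleftrightarrow>
     (\<exists>f. inj_on f (set (fst \<alpha>)) \<and> fst \<beta> = map f (fst \<alpha>) \<and>
          (\<forall>X \<in> set (fst \<alpha>). snd \<beta> (f X) = snd \<alpha> X))"

text \<open>
  In the shift move the letter \<open>A'\<close> may be a new letter or \<open>A\<close> itself with its type changed.  In each
  rule the two Gauss word conditions make the displayed letters distinct from one another and from
  those of \<open>x\<close>, \<open>y\<close>, \<open>z\<close>, \<open>u\<close>.
\<close>
inductive move :: "nanoword \<Rightarrow> nanoword \<Rightarrow> bool" where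
  iso: "gauss_word (fst \<alpha>) \<Longrightarrow> gauss_word (fst \<beta>) \<Longrightarrow> isomorphic \<alpha> \<beta> \<Longrightarrow> move \<alpha> \<beta>"
| shift: "gauss_word ([A] @ x @ [A] @ y) \<Longrightarrow> gauss_word (x @ [A'] @ y @ [A']) \<Longrightarrow>
    t' A' \<noteq> t A \<Longrightarrow> (\<forall>X \<in> set x \<union> set y. t' X = t X) \<Longrightarrow>
    move ([A] @ x @ [A] @ y, t) (x @ [A'] @ y @ [A'], t')"
| H1: "gauss_word (x @ [A, A] @ y) \<Longrightarrow> gauss_word (x @ y) \<Longrightarrow>
    move (x @ [A, A] @ y, t) (x @ y, t)"
| H2: "gauss_word (x @ [A, B] @ y @ [B, A] @ z) \<Longrightarrow> gauss_word (x @ y @ z) \<Longrightarrow> t A \<noteq> t B \<Longrightarrow>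
    move (x @ [A, B] @ y @ [B, A] @ z, t) (x @ y @ z, t)"
| H3: "gauss_word (x @ [A, B] @ y @ [A, C] @ z @ [B, C] @ u) \<Longrightarrow>
    gauss_word (x @ [B, A] @ y @ [C, A] @ z @ [C, B] @ u) \<Longrightarrow> t A = t B \<Longrightarrow> t B = t C \<Longrightarrow>
    move (x @ [A, B] @ y @ [A, C] @ z @ [B, C] @ u, t)
         (x @ [B, A] @ y @ [C, A] @ z @ [C, B] @ u, t)"

definition homotopy :: "nanoword rel" where
  "homotopy = {(\<alpha>, \<beta>). \<alpha> \<in> nanowords \<and> \<beta> \<in> nanowords \<and> equivclp move \<alpha> \<beta>}"

lemma equiv_homotopy: "equiv nanowords homotopy"
  unfolding homotopy_def
  by (intro equivI) (auto simp: refl_on_def sym_def trans_def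
      intro: equivclp_sym equivclp_trans)

definition virtual_strings :: "nanoword set set" where
  "virtual_strings = nanowords // homotopy"

definition link :: "nanoword \<Rightarrow> nat \<Rightarrow> nat \<Rightarrow> int" where
  "link \<alpha> A B =
     (let v = filter (\<lambda>X. X \<in> {A, B}) (fst \<alpha>); same = (snd \<alpha> A = snd \<alpha> B) in
      if A = B then 0
      else if v = [A, B, A, B] then (if same then 1 else - 1)
      else if v = [B, A, B, A] then (if same then - 1 else 1)
      else 0)"

definition link_sum :: "nanoword \<Rightarrow> nat \<Rightarrow> int" where
  "link_sum \<alpha> X = (\<Sum>Y \<in> set (fst \<alpha>). link \<alpha> X Y)"

definition nanoword_covering0 :: "nanoword \<Rightarrow> nanoword" where
  "nanoword_covering0 \<alpha> = (filter (\<lambda>X. link_sum \<alpha> X = 0) (fst \<alpha>), snd \<alpha>)"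

lemma nanoword_covering0_in_nanowords:
  "\<alpha> \<in> nanowords \<Longrightarrow> nanoword_covering0 \<alpha> \<in> nanowords"
proof -
  have "count_list (filter P w) X = count_list w X" if "P X" for P w and X :: nat
    using that by (induction w) auto
  then show "\<alpha> \<in> nanowords \<Longrightarrow> nanoword_covering0 \<alpha> \<in> nanowords"
    by (auto simp: nanowords_def nanoword_covering0_def gauss_word_def)
qed

text \<open>
  The usual definition of a function on a quotient: since homotopic nanowords have homotopic
  \<open>0\<close>-coverings, all members of the union below are the same homotopy class.
\<close>
definition covering0 :: "nanoword set \<Rightarrow> nanoword set" where
  "covering0 \<Gamma> = (\<Union>\<alpha> \<in> \<Gamma>. homotopy `` {nanoword_covering0 \<alpha>})"

end

(*
  Smoothing a flat curve at a crossing X leaves a loop, and the homological intersection number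
  b(X, Y) of two such loops depends on the word only.  On the letters with n(X) = 0 the complementary
  loop has the opposite intersection numbers, so an H1 move creates or deletes a letter with a zero
  row in the skew-symmetric matrix b, an H2 move a pair of letters with opposite rows (or letters
  outside this set), and the other moves preserve b.  Hence the sum over X of (sum over Y of
  b(X, Y)^3)^3 is a homotopy invariant.  It is additive under concatenation on disjoint alphabets, and
  a nine-letter nanoword with n = 0 for all letters has a non-zero value, so its powers represent
  infinitely many virtual strings, all fixed by the 0-covering.
*)
theory Submission
  imports Defs
begin

section \<open>Signs, arcs and intersection numbers of loops\<close>

text \<open>With types as signs, the distinction between equal and different types in
  \<open>link\<close> becomes a product.\<close>

fun type_sign :: "letter_type \<Rightarrow> int" where
  "type_sign Type_a = 1"
| "type_sign Type_b = -1"

lemma type_sign_neq: "s \<noteq> s' \<Longrightarrow> type_sign s = - type_sign s'"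
  by (cases s; cases s') auto

lemma type_sign_nonzero [simp]: "type_sign s \<noteq> 0"
  by (cases s) auto

definition pair_word :: "'a list \<Rightarrow> 'a \<Rightarrow> 'a \<Rightarrow> 'a list" where
  "pair_word w X Y = filter (\<lambda>Z. Z \<in> {X, Y}) w"

text \<open>
  The position of the first (\<open>arc1\<close>) and of the second (\<open>arc2\<close>) occurrence of \<open>C\<close> relative to the
  segment of the word between the two occurrences of \<open>X\<close>: outside 0, at an end 1, inside 2.  The ends
  carry half the weight of the inside, which makes \<open>crossing\<close> four times the intersection number.
\<close>
definition arc1 :: "'a list \<Rightarrow> 'a \<Rightarrow> 'a \<Rightarrow> int" where
  "arc1 w X C = (if X = C then 1
     else if pair_word w X C \<in> {[X, C, X, C], [X, C, C, X]} then 2 else 0)"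

definition arc2 :: "'a list \<Rightarrow> 'a \<Rightarrow> 'a \<Rightarrow> int" where
  "arc2 w X C = (if X = C then 1
     else if pair_word w X C \<in> {[C, X, C, X], [X, C, C, X]} then 2 else 0)"

text \<open>A letter \<open>C\<close> contributes when one loop runs along its first strand and the
  other along its second, with opposite signs for the two possibilities. The two leading signs
  offset the negation that a shift of \<open>X\<close> or \<open>Y\<close> causes in the
  sum.\<close>

definition crossing :: "nanoword \<Rightarrow> nat \<Rightarrow> nat \<Rightarrow> int" where
  "crossing \<alpha> X Y = type_sign (snd \<alpha> X) * type_sign (snd \<alpha> Y) *
     (\<Sum>C\<in>set (fst \<alpha>). type_sign (snd \<alpha> C) *
        (arc1 (fst \<alpha>) X C * arc2 (fst \<alpha>) Y C - arc2 (fst \<alpha>) X C * arc1 (fst \<alpha>) Y C))"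

text \<open>
  Odd powers make opposite rows and columns cancel.  The first power inside would not do: all row sums
  vanish for \<open>base_word\<close> below.
\<close>
definition odd_sum :: "'a set \<Rightarrow> ('a \<Rightarrow> 'a \<Rightarrow> int) \<Rightarrow> int" where
  "odd_sum K b = (\<Sum>X\<in>K. (\<Sum>Y\<in>K. b X Y ^ 3) ^ 3)"

text \<open>These are the letters that the 0-covering keeps. Complementing the loop at another
  letter negates its intersection number with the loop at \<open>Y\<close> only if the loop at
  \<open>Y\<close> has intersection number zero with the whole curve, that is, if \<open>Y\<close>
  lies in this set.\<close>

definition kernel :: "nanoword \<Rightarrow> nat set" where
  "kernel \<alpha> = {X \<in> set (fst \<alpha>). link_sum \<alpha> X = 0}"

definition crossing_invariant :: "nanoword \<Rightarrow> int" where
  "crossing_invariant \<alpha> = odd_sum (kernel \<alpha>) (crossing \<alpha>)"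

lemma pair_word_commute: "pair_word w X Y = pair_word w Y X"
  by (simp add: pair_word_def insert_commute)

lemma arc_same [simp]: "arc1 w X X = 1" "arc2 w X X = 1"
  by (simp_all add: arc1_def arc2_def)

lemma crossing_antisym: "crossing \<alpha> X Y = - crossing \<alpha> Y X"
  by (simp add: crossing_def sum_subtractf algebra_simps)

lemma crossing_self [simp]: "crossing \<alpha> X X = 0"
  by (simp add: crossing_def)

text \<open>For distinct letters the difference of the arcs is 2 on the pattern XCXC, -2 on CXCX and
  0 otherwise. So n(X) is, up to the sign of \<open>X\<close>, the intersection number of the loop
  at \<open>X\<close> with the whole curve. The factor 2 comes from the weights of the arcs; later
  equalities of n are proved for its double.\<close>

lemma double_link_sum:
  "2 * link_sum \<alpha> X = type_sign (snd \<alpha> X) *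
     (\<Sum>C\<in>set (fst \<alpha>). type_sign (snd \<alpha> C) * (arc1 (fst \<alpha>) X C - arc2 (fst \<alpha>) X C))"
proof -
  have "2 * link \<alpha> X C = type_sign (snd \<alpha> X) * type_sign (snd \<alpha> C) *
      (arc1 (fst \<alpha>) X C - arc2 (fst \<alpha>) X C)" for C
    by (cases "snd \<alpha> X"; cases "snd \<alpha> C")
      (auto simp: link_def arc1_def arc2_def pair_word_def Let_def)
  then show ?thesis
    by (simp add: link_sum_def sum_distrib_left mult.assoc)
qed

section \<open>Arcs under restriction and relabelling\<close>

lemma pair_word_filter:
  "P X \<Longrightarrow> P Y \<Longrightarrow> pair_word (filter P w) X Y = pair_word w X Y"
  by (induction w) (auto simp: pair_word_def)

lemma arc_filter:
  assumes "P X" "P C"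
  shows "arc1 (filter P w) X C = arc1 w X C" "arc2 (filter P w) X C = arc2 w X C"
  using assms by (simp_all add: arc1_def arc2_def pair_word_filter)

text \<open>Arcs see only the two letters concerned. A move that displays only letters of
  \<open>D\<close> therefore leaves the arcs between all other letters alone.\<close>

lemma arc_cong:
  assumes "filter (\<lambda>Z. Z \<notin> D) w = filter (\<lambda>Z. Z \<notin> D) w'" "X \<notin> D" "C \<notin> D"
  shows "arc1 w X C = arc1 w' X C" "arc2 w X C = arc2 w' X C"
  using arc_filter [of "\<lambda>Z. Z \<notin> D" X C w] arc_filter [of "\<lambda>Z. Z \<notin> D" X C w'] assms
  by simp_all

lemma pair_word_map:
  assumes "inj_on f (insert X (insert Y (set w)))"
  shows "pair_word (map f w) (f X) (f Y) = map f (pair_word w X Y)"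
  using assms by (induction w) (auto simp: pair_word_def inj_on_def)

lemma arc_map:
  assumes "inj_on f (set w)" "X \<in> set w" "C \<in> set w"
  shows "arc1 (map f w) (f X) (f C) = arc1 w X C" "arc2 (map f w) (f X) (f C) = arc2 w X C"
proof -
  \<comment> \<open>Injectivity turns the comparison of the relabelled pair word with a pattern into
    the same comparison for the original word.\<close>
  have *: "map f (pair_word w X C) = map f v \<longleftrightarrow> pair_word w X C = v" if "set v \<subseteq> {X, C}" for v
    using assms that by (intro inj_on_map_eq_map) (auto simp: inj_on_def pair_word_def)
  have eq: "f X = f C \<longleftrightarrow> X = C"
    using assms by (auto simp: inj_on_def)
  have pw: "pair_word (map f w) (f X) (f C) = map f (pair_word w X C)"
    using assms by (intro pair_word_map) (simp add: insert_absorb)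
  show "arc1 (map f w) (f X) (f C) = arc1 w X C"
    using *[of "[X, C, X, C]"] *[of "[X, C, C, X]"] by (simp add: arc1_def eq pw)
  show "arc2 (map f w) (f X) (f C) = arc2 w X C"
    using *[of "[C, X, C, X]"] *[of "[X, C, C, X]"] by (simp add: arc2_def eq pw)
qed

lemma gauss_word_filter: "gauss_word w \<Longrightarrow> gauss_word (filter P w)"
proof -
  have "count_list (filter P w) X = count_list w X" if "P X" for X
    using that by (induction w) auto
  then show "gauss_word w \<Longrightarrow> gauss_word (filter P w)"
    by (auto simp: gauss_word_def)
qed

section \<open>Arcs computed from occurrence counts\<close>

lemma pair_word_replicate:
  "A \<notin> set x \<Longrightarrow> pair_word x A Y = replicate (count_list x Y) Y"
  by (induction x) (auto simp: pair_word_def)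

lemma pair_word_append: "pair_word (x @ y) A Y = pair_word x A Y @ pair_word y A Y"
  by (simp add: pair_word_def)

lemma pair_word_Cons:
  "pair_word (Z # x) A Y = (if Z = A \<or> Z = Y then [Z] else []) @ pair_word x A Y"
  by (simp add: pair_word_def)

text \<open>The two occurrences of \<open>A\<close> cut the word into three pieces, over which the
  two occurrences of \<open>Y\<close> are distributed in one of six ways; each way fixes the pair
  word. The first \<open>A\<close>, for instance, lies between the occurrences of \<open>Y\<close>
  iff exactly one of these is in \<open>u\<close>. For the moves, arcs thus reduce to arithmetic
  with counts.\<close>

lemma arc_decomp:
  assumes w: "gauss_word w" "w = u @ A # v @ A # z" and Y: "Y \<in> set w" "Y \<noteq> A"
  shows "arc1 w A Y = (if count_list u Y = 0 \<and> count_list v Y > 0 then 2 else 0)"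
    "arc2 w A Y = (if count_list z Y = 0 \<and> count_list v Y > 0 then 2 else 0)"
    "arc1 w Y A = (if count_list u Y = 1 then 2 else 0)"
    "arc2 w Y A = (if count_list z Y = 1 then 2 else 0)"
proof -
  have "count_list w Y = 2"
    using w(1) Y(1) by (simp add: gauss_word_def)
  then have n: "count_list u Y + count_list v Y + count_list z Y = 2"
    using Y(2) by (simp add: w(2) count_list_append)
  have "count_list w A = 2"
    using w by (simp add: gauss_word_def)
  then have "A \<notin> set u" "A \<notin> set v" "A \<notin> set z"
    using w by (auto simp: count_list_append count_list_0_iff)
  then have "pair_word w A Y = replicate (count_list u Y) Y @ A # replicate (count_list v Y) Y @
      A # replicate (count_list z Y) Y"
    using Y(2) by (simp add: w(2) pair_word_append pair_word_Cons pair_word_replicate)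
  then have pw: "pair_word w A Y = replicate (count_list u Y) Y @ A # replicate (count_list v Y) Y @
      A # replicate (count_list z Y) Y" "pair_word w Y A = pair_word w A Y"
    by (simp_all add: pair_word_commute)
  have "count_list u Y \<in> {0, 1, 2}" "count_list v Y \<in> {0, 1, 2}"
    using n by auto
  with n consider
      "count_list u Y = 0" "count_list v Y = 0" "count_list z Y = 2"
    | "count_list u Y = 0" "count_list v Y = 1" "count_list z Y = 1"
    | "count_list u Y = 0" "count_list v Y = 2" "count_list z Y = 0"
    | "count_list u Y = 1" "count_list v Y = 0" "count_list z Y = 1"
    | "count_list u Y = 1" "count_list v Y = 1" "count_list z Y = 0"
    | "count_list u Y = 2" "count_list v Y = 0" "count_list z Y = 0"
    by auto
  then have "arc1 w A Y = (if count_list u Y = 0 \<and> count_list v Y > 0 then 2 else 0) \<and>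
    arc2 w A Y = (if count_list z Y = 0 \<and> count_list v Y > 0 then 2 else 0) \<and>
    arc1 w Y A = (if count_list u Y = 1 then 2 else 0) \<and>
    arc2 w Y A = (if count_list z Y = 1 then 2 else 0)"
    by cases (use Y(2) in \<open>simp_all add: arc1_def arc2_def pw numeral_2_eq_2\<close>)
  then show "arc1 w A Y = (if count_list u Y = 0 \<and> count_list v Y > 0 then 2 else 0)"
    "arc2 w A Y = (if count_list z Y = 0 \<and> count_list v Y > 0 then 2 else 0)"
    "arc1 w Y A = (if count_list u Y = 1 then 2 else 0)"
    "arc2 w Y A = (if count_list z Y = 1 then 2 else 0)"
    by blast+
qed

section \<open>Cancellation in sums of odd powers\<close>

lemma odd_sum_cong:
  "K = K' \<Longrightarrow> (\<And>X Y. X \<in> K \<Longrightarrow> Y \<in> K \<Longrightarrow> b X Y = b' X Y) \<Longrightarrow> odd_sum K b = odd_sum K' b'"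
  by (simp add: odd_sum_def)

lemma odd_sum_remove_null:
  assumes "finite K" "A \<notin> K" "\<And>Y. Y \<in> insert A K \<Longrightarrow> b A Y = 0" "\<And>X. X \<in> K \<Longrightarrow> b X A = 0"
  shows "odd_sum (insert A K) b = odd_sum K b"
  using assms by (simp add: odd_sum_def)

text \<open>Cubing commutes with negation. In every row the entries of columns \<open>A\<close> and
  \<open>B\<close> cancel; after that the row sums of \<open>A\<close> and \<open>B\<close> are
  opposite, and so are their cubes.\<close>

lemma odd_sum_remove_pair:
  assumes "finite K" "A \<notin> K" "B \<notin> K" "A \<noteq> B"
    and row: "\<And>Y. Y \<in> insert A (insert B K) \<Longrightarrow> b A Y = - b B Y"
    and col: "\<And>X. X \<in> insert A (insert B K) \<Longrightarrow> b X A = - b X B"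
  shows "odd_sum (insert A (insert B K)) b = odd_sum K b"
  using assms by (simp add: odd_sum_def sum_negf)

section \<open>Invariance under isomorphism\<close>

lemma link_sum_isomorphic:
  assumes f: "inj_on f (set w)" "\<And>X. X \<in> set w \<Longrightarrow> t' (f X) = t X" and "X \<in> set w"
  shows "link_sum (map f w, t') (f X) = link_sum (w, t) X"
proof -
  have "2 * link_sum (map f w, t') (f X) = 2 * link_sum (w, t) X"
    using assms by (simp add: double_link_sum sum.reindex arc_map)
  then show ?thesis by simp
qed

lemma crossing_isomorphic:
  assumes f: "inj_on f (set w)" "\<And>X. X \<in> set w \<Longrightarrow> t' (f X) = t X" and "X \<in> set w" "Y \<in> set w"
  shows "crossing (map f w, t') (f X) (f Y) = crossing (w, t) X Y"
  using assms by (simp add: crossing_def sum.reindex arc_map)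

lemma crossing_invariant_isomorphic:
  assumes "isomorphic \<alpha> \<beta>"
  shows "crossing_invariant \<alpha> = crossing_invariant \<beta>"
proof -
  obtain w t t' f where \<alpha>: "\<alpha> = (w, t)" and \<beta>: "\<beta> = (map f w, t')"
    and f: "inj_on f (set w)" "\<And>X. X \<in> set w \<Longrightarrow> t' (f X) = t X"
    using assms by (cases \<alpha>; cases \<beta>) (auto simp: isomorphic_def)
  have "kernel \<beta> = f ` kernel \<alpha>"
    using link_sum_isomorphic [where f = f and t = t and t' = t' and w = w, OF f] by (auto simp: \<alpha> \<beta> kernel_def)
  moreover have "inj_on f (kernel \<alpha>)"
    using f by (auto simp: \<alpha> kernel_def inj_on_def)
  moreover have "crossing \<beta> (f X) (f Y) = crossing \<alpha> X Y" if "X \<in> kernel \<alpha>" "Y \<in> kernel \<alpha>" for X Y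
    using that crossing_isomorphic [where f = f and t = t and t' = t' and w = w, OF f] by (auto simp: \<alpha> \<beta> kernel_def)
  ultimately show ?thesis
    by (simp add: crossing_invariant_def odd_sum_def sum.reindex)
qed

lemma covering0_isomorphic:
  assumes "isomorphic \<alpha> \<beta>"
  shows "isomorphic (nanoword_covering0 \<alpha>) (nanoword_covering0 \<beta>)"
proof -
  obtain w t t' f where \<alpha>: "\<alpha> = (w, t)" and \<beta>: "\<beta> = (map f w, t')"
    and f: "inj_on f (set w)" "\<And>X. X \<in> set w \<Longrightarrow> t' (f X) = t X"
    using assms by (cases \<alpha>; cases \<beta>) (auto simp: isomorphic_def)
  have "filter (\<lambda>X. link_sum \<beta> X = 0) (map f w) = map f (filter (\<lambda>X. link_sum \<alpha> X = 0) w)"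
    using link_sum_isomorphic [where f = f and t = t and t' = t' and w = w, OF f] by (auto simp: \<alpha> \<beta> filter_map intro!: filter_cong arg_cong [of _ _ "map f"])
  then show ?thesis
    using f by (auto simp: isomorphic_def nanoword_covering0_def \<alpha> \<beta> inj_on_def intro!: exI [of _ f])
qed


section \<open>The shift move\<close>

lemma gauss_word_count: "gauss_word w \<Longrightarrow> X \<in> set w \<Longrightarrow> count_list w X = 2"
  by (simp add: gauss_word_def)

text \<open>Moving the first \<open>A\<close> to the end exchanges the roles of the two occurrences
  of \<open>A\<close> and replaces the segment between them by the complementary one, which turns a
  weight into 2 minus that weight.\<close>

lemma shift_arcs:
  assumes w: "gauss_word w" "w = A # x @ A # y" "gauss_word w'" "w' = x @ A # y @ [A]"
  shows "X \<in> set w \<Longrightarrow> X \<noteq> A \<Longrightarrow> arc1 w' X A = arc2 w X A \<and> arc2 w' X A = arc1 w X A"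
    "C \<in> set w \<Longrightarrow> C \<noteq> A \<Longrightarrow> arc1 w' A C = 2 - arc1 w A C \<and> arc2 w' A C = 2 - arc2 w A C"
    "X \<noteq> A \<Longrightarrow> C \<noteq> A \<Longrightarrow> arc1 w' X C = arc1 w X C \<and> arc2 w' X C = arc2 w X C"
proof -
  have sets: "set w' = set w" using w by auto
  have n: "count_list x Y + count_list y Y = 2" if "Y \<in> set w" "Y \<noteq> A" for Y
    using gauss_word_count [OF w(1) that(1)] that(2) by (simp add: w(2) count_list_append)
  note d = arc_decomp [of w "[]" A x y] arc_decomp [of w' x A y "[]"]
  show "X \<in> set w \<Longrightarrow> X \<noteq> A \<Longrightarrow> arc1 w' X A = arc2 w X A \<and> arc2 w' X A = arc1 w X A"
    using n [of X] w(1,3) by (auto simp: d sets w(2,4) [symmetric])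
  show "C \<in> set w \<Longrightarrow> C \<noteq> A \<Longrightarrow> arc1 w' A C = 2 - arc1 w A C \<and> arc2 w' A C = 2 - arc2 w A C"
    using n [of C] w(1,3) by (auto simp: d sets w(2,4) [symmetric])
  have "filter (\<lambda>Z. Z \<notin> {A}) w' = filter (\<lambda>Z. Z \<notin> {A}) w"
    by (simp add: w(2,4))
  from arc_cong [OF this]
  show "X \<noteq> A \<Longrightarrow> C \<noteq> A \<Longrightarrow> arc1 w' X C = arc1 w X C \<and> arc2 w' X C = arc2 w X C"
    by simp
qed

text \<open>Swapping or complementing the arcs negates their difference, and the changed type of
  \<open>A\<close> negates the sign in front.\<close>

lemma shift_link_sum:
  assumes w: "gauss_word w" "w = A # x @ A # y" "gauss_word w'" "w' = x @ A # y @ [A]"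
    and t: "t' A \<noteq> t A" "\<And>X. X \<noteq> A \<Longrightarrow> t' X = t X" and X: "X \<in> set w"
  shows "link_sum (w', t') X = link_sum (w, t) X"
proof -
  have sets: "set w' = set w" using w by auto
  have tA: "type_sign (t' A) = - type_sign (t A)"
    using t(1) by (rule type_sign_neq)
  note arcs = shift_arcs [OF w]
  have "type_sign (t' X) * (type_sign (t' C) * (arc1 w' X C - arc2 w' X C)) =
      type_sign (t X) * (type_sign (t C) * (arc1 w X C - arc2 w X C))" if "C \<in> set w" for C
    using arcs(1) [of X] arcs(2) [of C] arcs(3) [of X C] tA t(2) X that
    by (cases "X = A"; cases "C = A") (auto; simp add: algebra_simps)+
  then have "2 * link_sum (w', t') X = 2 * link_sum (w, t) X"
    by (simp add: double_link_sum sets sum_distrib_left)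
  then show ?thesis by simp
qed

text \<open>The complementary loop at \<open>A\<close> meets the loop at \<open>Y\<close> in the
  intersection number of the whole curve with that loop minus the old number. The former vanishes
  since n(Y) = 0, and the changed sign of \<open>A\<close> absorbs the minus.\<close>

lemma shift_crossing:
  assumes w: "gauss_word w" "w = A # x @ A # y" "gauss_word w'" "w' = x @ A # y @ [A]"
    and t: "t' A \<noteq> t A" "\<And>X. X \<noteq> A \<Longrightarrow> t' X = t X"
    and XY: "X \<in> kernel (w, t)" "Y \<in> kernel (w, t)"
  shows "crossing (w', t') X Y = crossing (w, t) X Y"
proof -
  have sets: "set w' = set w" using w by auto
  have tA: "type_sign (t' A) = - type_sign (t A)"
    using t(1) by (rule type_sign_neq)
  note arcs = shift_arcs [OF w]
  have mixed: "crossing (w', t') A Y = crossing (w, t) A Y" if Y: "Y \<in> kernel (w, t)" "Y \<noteq> A" for Y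
  proof -
    have Yw: "Y \<in> set w" and "link_sum (w, t) Y = 0"
      using Y by (auto simp: kernel_def)
    then have 0: "(\<Sum>C\<in>set w. type_sign (t C) * (arc1 w Y C - arc2 w Y C)) = 0"
      using double_link_sum [of "(w, t)" Y] by simp
    \<comment> \<open>The last term comes from expanding 2 minus an arc; its sum over
      \<open>C\<close> is zero by n(Y) = 0. The weight 1 at the ends makes the identity hold for
      \<open>C = A\<close> too.\<close>
    have "type_sign (t' C) * (arc1 w' A C * arc2 w' Y C - arc2 w' A C * arc1 w' Y C) =
       - (type_sign (t C) * (arc1 w A C * arc2 w Y C - arc2 w A C * arc1 w Y C))
       - 2 * (type_sign (t C) * (arc1 w Y C - arc2 w Y C))" if "C \<in> set w" for C
      using arcs(1) [of Y] arcs(2) [of C] arcs(3) [of Y C] tA t(2) Y Yw that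
      by (cases "C = A") (auto; simp add: algebra_simps)+
    then have "(\<Sum>C\<in>set w. type_sign (t' C) * (arc1 w' A C * arc2 w' Y C - arc2 w' A C * arc1 w' Y C)) =
       - (\<Sum>C\<in>set w. type_sign (t C) * (arc1 w A C * arc2 w Y C - arc2 w A C * arc1 w Y C))"
      using 0 by (simp add: sum_subtractf sum_negf sum_distrib_left [symmetric])
    then show ?thesis
      using Y(2) t(2) by (simp add: crossing_def sets tA)
  qed
  have "crossing (w', t') X Y = crossing (w, t) X Y" if "X \<noteq> A" "Y \<noteq> A"
  proof -
    have "type_sign (t' C) * (arc1 w' X C * arc2 w' Y C - arc2 w' X C * arc1 w' Y C) =
       type_sign (t C) * (arc1 w X C * arc2 w Y C - arc2 w X C * arc1 w Y C)" if "C \<in> set w" for C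
      using arcs(1) [of X] arcs(1) [of Y] arcs(3) [of X C] arcs(3) [of Y C] tA t(2) XY that
        \<open>X \<noteq> A\<close> \<open>Y \<noteq> A\<close>
      by (cases "C = A") (auto simp: algebra_simps kernel_def)
    then show ?thesis
      using that t(2) by (simp add: crossing_def sets)
  qed
  then show ?thesis
    using mixed [of X] mixed [of Y] XY crossing_antisym [of "(w', t')" X Y]
      crossing_antisym [of "(w, t)" X Y]
    by (cases "X = A"; cases "Y = A") auto
qed

section \<open>The H1 move\<close>

text \<open>Nothing lies between the adjacent occurrences of \<open>A\<close>, and they have the
  same position relative to the segment of any other letter.\<close>

lemma H1_arcs:
  assumes w: "gauss_word w" "w = x @ A # A # y" "w' = x @ y"
  shows "set w = insert A (set w')" "A \<notin> set w'"
    "X \<in> set w' \<Longrightarrow> arc1 w X A = arc2 w X A"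
    "C \<in> set w' \<Longrightarrow> arc1 w A C = 0 \<and> arc2 w A C = 0"
    "X \<in> set w' \<Longrightarrow> C \<in> set w' \<Longrightarrow> arc1 w X C = arc1 w' X C \<and> arc2 w X C = arc2 w' X C"
proof -
  show sets: "set w = insert A (set w')"
    using w by auto
  have "count_list w A = 2"
    using w by (intro gauss_word_count) auto
  then show A: "A \<notin> set w'"
    using w by (auto simp: count_list_append count_list_0_iff)
  then have [simp]: "Y \<in> set w' \<Longrightarrow> Y \<noteq> A" for Y
    by blast
  have n: "count_list x Y + count_list y Y = 2" if "Y \<in> set w'" for Y
  proof -
    have "Y \<noteq> A" "count_list w Y = 2"
      using gauss_word_count [OF w(1)] that sets A by auto
    then show ?thesis
      by (simp add: w(2) count_list_append)
  qed
  have "w = x @ A # [] @ A # y"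
    using w by simp
  note d = arc_decomp [OF w(1) this]
  show "X \<in> set w' \<Longrightarrow> arc1 w X A = arc2 w X A"
    using n [of X] d(3,4) [of X] sets by auto
  show "C \<in> set w' \<Longrightarrow> arc1 w A C = 0 \<and> arc2 w A C = 0"
    using d(1,2) [of C] sets by auto
  have "filter (\<lambda>Z. Z \<notin> {A}) w = filter (\<lambda>Z. Z \<notin> {A}) w'"
    by (simp add: w)
  from arc_cong [OF this]
  show "X \<in> set w' \<Longrightarrow> C \<in> set w' \<Longrightarrow> arc1 w X C = arc1 w' X C \<and> arc2 w X C = arc2 w' X C"
    using A by auto
qed

lemma H1_link_sum:
  assumes w: "gauss_word w" "w = x @ A # A # y" "w' = x @ y"
  shows "X \<in> set w' \<Longrightarrow> link_sum (w, t) X = link_sum (w', t) X" "link_sum (w, t) A = 0"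
proof -
  note arcs = H1_arcs [OF w]
  have "2 * link_sum (w, t) X = 2 * link_sum (w', t) X" if "X \<in> set w'"
    using that arcs by (simp add: double_link_sum)
  then show "X \<in> set w' \<Longrightarrow> link_sum (w, t) X = link_sum (w', t) X" by simp
  have "2 * link_sum (w, t) A = 0"
    using arcs by (simp add: double_link_sum)
  then show "link_sum (w, t) A = 0" by simp
qed

lemma H1_crossing:
  assumes w: "gauss_word w" "w = x @ A # A # y" "w' = x @ y"
  shows "X \<in> set w' \<Longrightarrow> Y \<in> set w' \<Longrightarrow> crossing (w, t) X Y = crossing (w', t) X Y"
    "Y \<in> set w \<Longrightarrow> crossing (w, t) A Y = 0"
proof -
  note arcs = H1_arcs [OF w]
  show "X \<in> set w' \<Longrightarrow> Y \<in> set w' \<Longrightarrow> crossing (w, t) X Y = crossing (w', t) X Y"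
    using arcs by (simp add: crossing_def)
  show "Y \<in> set w \<Longrightarrow> crossing (w, t) A Y = 0"
    using arcs by (cases "Y = A") (auto simp: crossing_def)
qed

section \<open>The H2 move\<close>

text \<open>Each occurrence of \<open>A\<close> is adjacent to one of \<open>B\<close>, so no other
  letter tells them apart. Between themselves they are nested, with \<open>B\<close> inside.\<close>

lemma H2_arcs:
  assumes w: "gauss_word w" "w = x @ A # B # y @ B # A # z" "w' = x @ y @ z" and "A \<noteq> B"
  shows "set w = insert A (insert B (set w'))" "A \<notin> set w'" "B \<notin> set w'"
    "X \<in> set w' \<Longrightarrow> arc1 w X A = arc1 w X B \<and> arc2 w X A = arc2 w X B"
    "C \<in> set w' \<Longrightarrow> arc1 w A C = arc1 w B C \<and> arc2 w A C = arc2 w B C"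
    "arc1 w A B = 2" "arc2 w A B = 2" "arc1 w B A = 0" "arc2 w B A = 0"
    "X \<in> set w' \<Longrightarrow> C \<in> set w' \<Longrightarrow> arc1 w X C = arc1 w' X C \<and> arc2 w X C = arc2 w' X C"
proof -
  show sets: "set w = insert A (insert B (set w'))"
    using w by auto
  have "count_list w A = 2" "count_list w B = 2"
    using gauss_word_count [OF w(1)] sets by blast+
  then have 0: "count_list x A = 0" "count_list y A = 0" "count_list z A = 0"
    "count_list x B = 0" "count_list y B = 0" "count_list z B = 0"
    using w \<open>A \<noteq> B\<close> by (auto simp: count_list_append count_list_0_iff)
  then show A: "A \<notin> set w'" and B: "B \<notin> set w'"
    using w by (auto simp: count_list_0_iff)
  then have [simp]: "Y \<in> set w' \<Longrightarrow> Y \<noteq> A" "Y \<in> set w' \<Longrightarrow> Y \<noteq> B"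
    "Y \<in> set w' \<Longrightarrow> A \<noteq> Y" "Y \<in> set w' \<Longrightarrow> B \<noteq> Y" for Y
    by blast+
  have wB: "w = (x @ [A]) @ B # y @ B # A # z" and wA: "w = x @ A # (B # y @ [B]) @ A # z"
    using w by auto
  note dA = arc_decomp [OF w(1) wA] and dB = arc_decomp [OF w(1) wB]
  show "X \<in> set w' \<Longrightarrow> arc1 w X A = arc1 w X B \<and> arc2 w X A = arc2 w X B"
    using A B sets dA(3,4) [of X] dB(3,4) [of X] by (auto simp: count_list_append)
  show "C \<in> set w' \<Longrightarrow> arc1 w A C = arc1 w B C \<and> arc2 w A C = arc2 w B C"
    using A B sets dA(1,2) [of C] dB(1,2) [of C] by (auto simp: count_list_append)
  show "arc1 w A B = 2" "arc2 w A B = 2" "arc1 w B A = 0" "arc2 w B A = 0"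
    using sets \<open>A \<noteq> B\<close> dA(1,2) [of B] dB(1,2) [of A] 0 by (auto simp: count_list_append)
  have "filter (\<lambda>Z. Z \<notin> {A, B}) w = filter (\<lambda>Z. Z \<notin> {A, B}) w'"
    by (simp add: w)
  from arc_cong [OF this]
  show "X \<in> set w' \<Longrightarrow> C \<in> set w' \<Longrightarrow> arc1 w X C = arc1 w' X C \<and> arc2 w X C = arc2 w' X C"
    using A B by auto
qed

text \<open>Equal arcs with opposite signs cancel. By the second claim, \<open>A\<close> and
  \<open>B\<close> are both in the kernel or both outside it.\<close>

lemma H2_link_sum:
  assumes w: "gauss_word w" "w = x @ A # B # y @ B # A # z" "w' = x @ y @ z" and "A \<noteq> B"
    and t: "t A \<noteq> t B"
  shows "X \<in> set w' \<Longrightarrow> link_sum (w, t) X = link_sum (w', t) X"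
    "link_sum (w, t) A = - link_sum (w, t) B"
proof -
  note arcs = H2_arcs [OF w \<open>A \<noteq> B\<close>]
  note tA = type_sign_neq [OF t]
  have "2 * link_sum (w, t) X = 2 * link_sum (w', t) X" if "X \<in> set w'"
    using that arcs \<open>A \<noteq> B\<close> by (simp add: double_link_sum tA)
  then show "X \<in> set w' \<Longrightarrow> link_sum (w, t) X = link_sum (w', t) X" by simp
  have "2 * link_sum (w, t) A = - 2 * link_sum (w, t) B"
    using arcs \<open>A \<noteq> B\<close> by (simp add: double_link_sum tA)
  then show "link_sum (w, t) A = - link_sum (w, t) B" by simp
qed

lemma H2_crossing:
  assumes w: "gauss_word w" "w = x @ A # B # y @ B # A # z" "w' = x @ y @ z" and "A \<noteq> B"
    and t: "t A \<noteq> t B"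
  shows "X \<in> set w' \<Longrightarrow> Y \<in> set w' \<Longrightarrow> crossing (w, t) X Y = crossing (w', t) X Y"
    "Y \<in> set w \<Longrightarrow> crossing (w, t) A Y = - crossing (w, t) B Y"
proof -
  note arcs = H2_arcs [OF w \<open>A \<noteq> B\<close>]
  note tA = type_sign_neq [OF t]
  show "X \<in> set w' \<Longrightarrow> Y \<in> set w' \<Longrightarrow> crossing (w, t) X Y = crossing (w', t) X Y"
    using arcs \<open>A \<noteq> B\<close> by (simp add: crossing_def tA)
  have AB: "crossing (w, t) A B = 0"
    using arcs \<open>A \<noteq> B\<close> by (simp add: crossing_def)
  then have "crossing (w, t) B A = 0"
    by (subst crossing_antisym) simp
  \<comment> \<open>At the letters \<open>A\<close> and \<open>B\<close> the loop of
    \<open>A\<close> has weights 1 and 2, that of \<open>B\<close> weights 0 and 1. As the signs are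
    opposite, both give the same total; only the leading signs differ.\<close>
  moreover have "crossing (w, t) A Y = - crossing (w, t) B Y" if "Y \<in> set w'"
    using that arcs \<open>A \<noteq> B\<close> by (simp add: crossing_def tA algebra_simps)
  ultimately show "Y \<in> set w \<Longrightarrow> crossing (w, t) A Y = - crossing (w, t) B Y"
    using AB arcs(1) by auto
qed

section \<open>The H3 move\<close>

text \<open>Only arcs among \<open>A\<close>, \<open>B\<close>, \<open>C\<close> change. For the
  remaining letters the adjacent pairs AB, AC, BC are indistinguishable, and the segment of
  \<open>B\<close> is that of \<open>A\<close> followed by that of \<open>C\<close>.\<close>

lemma H3_arcs:
  assumes w: "gauss_word w" "w = x @ A # B # y @ A # C # z @ B # C # u"
    and w': "gauss_word w'" "w' = x @ B # A # y @ C # A # z @ C # B # u"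
  defines "R \<equiv> set x \<union> set y \<union> set z \<union> set u"
  shows "set w = insert A (insert B (insert C R))" "set w' = insert A (insert B (insert C R))"
    "A \<notin> R" "B \<notin> R" "C \<notin> R" "A \<noteq> B" "A \<noteq> C" "B \<noteq> C"
    "X \<in> set w \<Longrightarrow> Y \<in> R \<Longrightarrow> arc1 w' X Y = arc1 w X Y \<and> arc2 w' X Y = arc2 w X Y"
    "X \<in> R \<Longrightarrow> D \<in> set w \<Longrightarrow> arc1 w' X D = arc1 w X D \<and> arc2 w' X D = arc2 w X D"
    "X \<in> R \<Longrightarrow> arc1 w X B = arc1 w X A \<and> arc2 w X A = arc1 w X C \<and> arc2 w X B = arc2 w X C"
    "Y \<in> R \<Longrightarrow> arc1 w B Y - arc2 w B Y = (arc1 w A Y - arc2 w A Y) + (arc1 w C Y - arc2 w C Y)"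
    "arc1 w A B = 2" "arc2 w A B = 0" "arc1 w A C = 0" "arc2 w A C = 0"
    "arc1 w B A = 0" "arc2 w B A = 2" "arc1 w B C = 2" "arc2 w B C = 0"
    "arc1 w C A = 0" "arc2 w C A = 0" "arc1 w C B = 0" "arc2 w C B = 2"
    "arc1 w' A B = 0" "arc2 w' A B = 0" "arc1 w' A C = 2" "arc2 w' A C = 0"
    "arc1 w' B A = 2" "arc2 w' B A = 2" "arc1 w' B C = 2" "arc2 w' B C = 2"
    "arc1 w' C A = 0" "arc2 w' C A = 2" "arc1 w' C B = 0" "arc2 w' C B = 0"
proof -
  show sets: "set w = insert A (insert B (insert C R))" "set w' = insert A (insert B (insert C R))"
    using w w' by (auto simp: R_def)
  have "count_list w A = 2" "count_list w B = 2" "count_list w C = 2"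
    using gauss_word_count [OF w(1)] sets by blast+
  then have ne: "A \<noteq> B" "A \<noteq> C" "B \<noteq> C"
    and 0: "count_list x A = 0" "count_list y A = 0" "count_list z A = 0" "count_list u A = 0"
    "count_list x B = 0" "count_list y B = 0" "count_list z B = 0" "count_list u B = 0"
    "count_list x C = 0" "count_list y C = 0" "count_list z C = 0" "count_list u C = 0"
    by (auto simp: w(2) count_list_append split: if_splits)
  then show "A \<notin> R" "B \<notin> R" "C \<notin> R" "A \<noteq> B" "A \<noteq> C" "B \<noteq> C"
    by (auto simp: R_def count_list_0_iff)
  then have [simp]: "Y \<in> R \<Longrightarrow> Y \<noteq> A" "Y \<in> R \<Longrightarrow> Y \<noteq> B" "Y \<in> R \<Longrightarrow> Y \<noteq> C"
    "Y \<in> R \<Longrightarrow> A \<noteq> Y" "Y \<in> R \<Longrightarrow> B \<noteq> Y" "Y \<in> R \<Longrightarrow> C \<noteq> Y" for Y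
    by blast+
  have n: "count_list x Y + count_list y Y + count_list z Y + count_list u Y = 2" if "Y \<in> R" for Y
  proof -
    have "count_list w Y = 2"
      using gauss_word_count [OF w(1)] that sets by auto
    then show ?thesis
      using that by (simp add: w(2) count_list_append)
  qed
  \<comment> \<open>Both words are cut at \<open>A\<close>, at \<open>B\<close> and at
    \<open>C\<close>, so that \<open>arc_decomp\<close> yields every arc that involves one of these
    and a remaining letter.\<close>
  have "w = x @ A # (B # y) @ A # (C # z @ B # C # u)"
    and "w = (x @ [A]) @ B # (y @ A # C # z) @ B # (C # u)"
    and "w = (x @ A # B # y @ [A]) @ C # (z @ [B]) @ C # u"
    using w(2) by simp_all
  note d = this [THEN arc_decomp(1) [OF w(1)]] this [THEN arc_decomp(2) [OF w(1)]]
    this [THEN arc_decomp(3) [OF w(1)]] this [THEN arc_decomp(4) [OF w(1)]]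
  have "w' = (x @ [B]) @ A # (y @ [C]) @ A # (z @ C # B # u)"
    and "w' = x @ B # (A # y @ C # A # z @ [C]) @ B # u"
    and "w' = (x @ B # A # y) @ C # (A # z) @ C # (B # u)"
    using w'(2) by simp_all
  note d' = this [THEN arc_decomp(1) [OF w'(1)]] this [THEN arc_decomp(2) [OF w'(1)]]
    this [THEN arc_decomp(3) [OF w'(1)]] this [THEN arc_decomp(4) [OF w'(1)]]
  note ds = d d' sets count_list_append
  have "filter (\<lambda>Z. Z \<notin> {A, B, C}) w' = filter (\<lambda>Z. Z \<notin> {A, B, C}) w"
    by (simp add: w(2) w'(2))
  note outer = arc_cong [OF this]
  show "X \<in> set w \<Longrightarrow> Y \<in> R \<Longrightarrow> arc1 w' X Y = arc1 w X Y \<and> arc2 w' X Y = arc2 w X Y"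
    using outer [of X Y] by (auto simp: ds)
  show "X \<in> R \<Longrightarrow> D \<in> set w \<Longrightarrow> arc1 w' X D = arc1 w X D \<and> arc2 w' X D = arc2 w X D"
    using outer [of X D] by (auto simp: ds)
  show "X \<in> R \<Longrightarrow> arc1 w X B = arc1 w X A \<and> arc2 w X A = arc1 w X C \<and> arc2 w X B = arc2 w X C"
    using n [of X] by (auto simp: ds)
  show "Y \<in> R \<Longrightarrow> arc1 w B Y - arc2 w B Y = (arc1 w A Y - arc2 w A Y) + (arc1 w C Y - arc2 w C Y)"
    using n [of Y] by (simp add: ds)
  show "arc1 w A B = 2" "arc2 w A B = 0" "arc1 w A C = 0" "arc2 w A C = 0"
    "arc1 w B A = 0" "arc2 w B A = 2" "arc1 w B C = 2" "arc2 w B C = 0"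
    "arc1 w C A = 0" "arc2 w C A = 0" "arc1 w C B = 0" "arc2 w C B = 2"
    "arc1 w' A B = 0" "arc2 w' A B = 0" "arc1 w' A C = 2" "arc2 w' A C = 0"
    "arc1 w' B A = 2" "arc2 w' B A = 2" "arc1 w' B C = 2" "arc2 w' B C = 2"
    "arc1 w' C A = 0" "arc2 w' C A = 2" "arc1 w' C B = 0" "arc2 w' C B = 0"
    using ne 0 0 [unfolded count_list_0_iff]
    by (simp_all add: arc1_def arc2_def w(2) w'(2) pair_word_append pair_word_Cons pair_word_replicate)
qed

text \<open>With equal types, the changes among the three letters compensate. The relation for n(B)
  shows that two of the three letters in the kernel force the third, as the 0-covering
  needs.\<close>

lemma H3_link_sum:
  assumes w: "gauss_word w" "w = x @ A # B # y @ A # C # z @ B # C # u"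
    and w': "gauss_word w'" "w' = x @ B # A # y @ C # A # z @ C # B # u"
    and t: "t A = t B" "t B = t C"
  shows "X \<in> set w \<Longrightarrow> link_sum (w', t) X = link_sum (w, t) X"
    "link_sum (w, t) B = link_sum (w, t) A + link_sum (w, t) C"
proof -
  define R where "R = set x \<union> set y \<union> set z \<union> set u"
  note arcs = H3_arcs [OF w w', folded R_def]
  have R: "finite R" by (simp add: R_def)
  have "2 * link_sum (w', t) X = 2 * link_sum (w, t) X" if "X \<in> set w"
    using that arcs R t by (auto simp: double_link_sum)
  then show "X \<in> set w \<Longrightarrow> link_sum (w', t) X = link_sum (w, t) X" by simp
  have "2 * link_sum (w, t) B = 2 * link_sum (w, t) A + 2 * link_sum (w, t) C"
    using arcs R t by (simp add: double_link_sum distrib_left [symmetric] sum.distrib [symmetric])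
  then show "link_sum (w, t) B = link_sum (w, t) A + link_sum (w, t) C" by simp
qed

lemma H3_crossing:
  assumes w: "gauss_word w" "w = x @ A # B # y @ A # C # z @ B # C # u"
    and w': "gauss_word w'" "w' = x @ B # A # y @ C # A # z @ C # B # u"
    and t: "t A = t B" "t B = t C" and XY: "X \<in> set w" "Y \<in> set w"
  shows "crossing (w', t) X Y = crossing (w, t) X Y"
proof -
  define R where "R = set x \<union> set y \<union> set z \<union> set u"
  note arcs = H3_arcs [OF w w', folded R_def]
  have R: "finite R" by (simp add: R_def)
  let ?d = "\<lambda>w D. arc1 w X D * arc2 w Y D - arc2 w X D * arc1 w Y D"
  have "?d w' D = ?d w D" if "D \<in> R" for D
    using arcs(9) [of X D] arcs(9) [of Y D] that XY by simp
  then have "(\<Sum>D\<in>R. type_sign (t D) * ?d w' D) = (\<Sum>D\<in>R. type_sign (t D) * ?d w D)"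
    by simp
  \<comment> \<open>The single terms may change, but their sum does not; equal types allow the
    common sign to be factored out.\<close>
  moreover have "?d w' A + ?d w' B + ?d w' C = ?d w A + ?d w B + ?d w C"
  proof -
    have cases: "Z = A \<or> Z = B \<or> Z = C \<or> Z \<in> R" if "Z \<in> set w" for Z
      using that arcs(1) by auto
    show ?thesis
      using cases [OF XY(1)] cases [OF XY(2)]
      by (elim disjE) (simp_all add: arcs)
  qed
  then have "type_sign (t C) * ?d w' A + type_sign (t C) * ?d w' B + type_sign (t C) * ?d w' C =
      type_sign (t C) * ?d w A + type_sign (t C) * ?d w B + type_sign (t C) * ?d w C"
    by (simp only: distrib_left [symmetric])
  ultimately show ?thesis
    using arcs(1-8) R t by (simp add: crossing_def)
qed

section \<open>Homotopy invariance of the crossing invariant\<close>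

lemma kernel_cong:
  assumes "set w' = set w" "\<And>X. X \<in> set w \<Longrightarrow> link_sum (w', t') X = link_sum (w, t) X"
  shows "kernel (w', t') = kernel (w, t)"
  using assms by (auto simp: kernel_def)

text \<open>A shift is a shift that keeps the letter \<open>A\<close> followed by an isomorphism.\<close>
lemma shift_relabel:
  assumes "gauss_word ([A] @ x @ [A] @ y)" "gauss_word (x @ [A'] @ y @ [A'])"
    "t' A' \<noteq> t A" "\<forall>X\<in>set x \<union> set y. t' X = t X"
  shows "gauss_word (x @ A # y @ [A])" "A \<notin> set x" "A \<notin> set y"
    "isomorphic (x @ A # y @ [A], t(A := t' A')) (x @ [A'] @ y @ [A'], t')"
proof -
  have count: "count_list (A # x @ A # y) A = 2" "count_list (x @ A' # y @ [A']) A' = 2"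
    using gauss_word_count [OF assms(1), of A] gauss_word_count [OF assms(2), of A'] by simp_all
  then show A: "A \<notin> set x" "A \<notin> set y"
    by (auto simp: count_list_append count_list_0_iff)
  have A': "A' \<notin> set x" "A' \<notin> set y"
    using count by (auto simp: count_list_append count_list_0_iff)
  have "count_list (x @ A # y @ [A]) X = count_list ([A] @ x @ [A] @ y) X" for X
    by (simp add: count_list_append)
  moreover have "set (x @ A # y @ [A]) = set ([A] @ x @ [A] @ y)"
    by auto
  ultimately show "gauss_word (x @ A # y @ [A])"
    using assms(1) unfolding gauss_word_def by metis
  show "isomorphic (x @ A # y @ [A], t(A := t' A')) (x @ [A'] @ y @ [A'], t')"
    unfolding isomorphic_def
  proof (intro exI conjI)
    show "inj_on (id(A := A')) (set (fst (x @ A # y @ [A], t(A := t' A'))))"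
      using A A' by (auto simp: inj_on_def)
    show "fst (x @ [A'] @ y @ [A'], t') = map (id(A := A')) (fst (x @ A # y @ [A], t(A := t' A')))"
      using A by (auto simp: map_idI)
    show "\<forall>X\<in>set (fst (x @ A # y @ [A], t(A := t' A'))).
        snd (x @ [A'] @ y @ [A'], t') ((id(A := A')) X) = snd (x @ A # y @ [A], t(A := t' A')) X"
      using A assms(4) by auto
  qed
qed

lemma crossing_invariant_move: "move \<alpha> \<beta> \<Longrightarrow> crossing_invariant \<alpha> = crossing_invariant \<beta>"
proof (induction rule: move.induct)
  case (iso \<alpha> \<beta>)
  then show ?case by (rule_tac crossing_invariant_isomorphic)
next
  case (shift A x y A' t' t)
  define w where "w = A # x @ A # y"
  define w' where "w' = x @ A # y @ [A]"
  define s where "s = t(A := t' A')"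
  note relabel = shift_relabel [OF shift, folded s_def w'_def]
  have w: "gauss_word w" "w = A # x @ A # y" "gauss_word w'" "w' = x @ A # y @ [A]"
    using shift(1) relabel(1) by (simp_all add: w_def w'_def)
  have t: "s A \<noteq> t A" "\<And>X. X \<noteq> A \<Longrightarrow> s X = t X"
    using shift by (auto simp: s_def)
  have "kernel (w', s) = kernel (w, t)"
    using w by (intro kernel_cong shift_link_sum [OF w, where t = t and t' = s, OF t]) auto
  then have "crossing_invariant (w', s) = crossing_invariant (w, t)"
    unfolding crossing_invariant_def
    by (intro odd_sum_cong) (auto intro!: shift_crossing [OF w, where t = t and t' = s, OF t])
  then show ?case
    using crossing_invariant_isomorphic [OF relabel(4)] by (simp add: w_def)
next
  case (H1 x A y t)
  define w where "w = x @ A # A # y"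
  define w' where "w' = x @ y"
  have w: "gauss_word w" "w = x @ A # A # y" "w' = x @ y"
    using H1 by (simp_all add: w_def w'_def)
  have sets: "set w = insert A (set w')" "A \<notin> set w'"
    by (rule H1_arcs [OF w])+
  note link = H1_link_sum [OF w, where t = t] and cross = H1_crossing [OF w, where t = t]
  have kernel: "kernel (w, t) = insert A (kernel (w', t))"
    using sets link by (auto simp: kernel_def)
  have null: "crossing (w, t) A Y = 0" "crossing (w, t) Y A = 0" if "Y \<in> insert A (set w')" for Y
    using that cross(2) [of Y] sets crossing_antisym [of "(w, t)" Y A] by auto
  have "odd_sum (insert A (kernel (w', t))) (crossing (w, t)) = odd_sum (kernel (w', t)) (crossing (w, t))"
    using sets null by (intro odd_sum_remove_null) (auto simp: kernel_def)
  also have "\<dots> = odd_sum (kernel (w', t)) (crossing (w', t))"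
    by (intro odd_sum_cong refl cross(1)) (auto simp: kernel_def)
  finally have "crossing_invariant (w, t) = crossing_invariant (w', t)"
    by (simp add: crossing_invariant_def kernel)
  then show ?case
    by (simp add: w_def w'_def)
next
  case (H2 x A B y z t)
  define w where "w = x @ A # B # y @ B # A # z"
  define w' where "w' = x @ y @ z"
  have w: "gauss_word w" "w = x @ A # B # y @ B # A # z" "w' = x @ y @ z" and "A \<noteq> B"
    using H2 by (auto simp: w_def w'_def)
  have sets: "set w = insert A (insert B (set w'))" "A \<notin> set w'" "B \<notin> set w'"
    by (rule H2_arcs [OF w \<open>A \<noteq> B\<close>])+
  note link = H2_link_sum [OF w \<open>A \<noteq> B\<close> \<open>t A \<noteq> t B\<close>]
    and cross = H2_crossing [OF w \<open>A \<noteq> B\<close> \<open>t A \<noteq> t B\<close>]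
  \<comment> \<open>Since n(A) = - n(B), the two letters enter the kernel together, and then their
    rows and columns cancel; otherwise the kernels agree already.\<close>
  have kernel: "kernel (w, t) = (if link_sum (w, t) A = 0 then insert A (insert B (kernel (w', t)))
      else kernel (w', t))"
    using sets link by (auto simp: kernel_def)
  have "crossing (w, t) X A = - crossing (w, t) X B" if "X \<in> set w" for X
    using cross(2) [OF that] crossing_antisym [of "(w, t)" X] by simp
  then have "odd_sum (insert A (insert B (kernel (w', t)))) (crossing (w, t)) =
      odd_sum (kernel (w', t)) (crossing (w, t))"
    using sets \<open>A \<noteq> B\<close> by (intro odd_sum_remove_pair cross(2)) (auto simp: kernel_def)
  then have "odd_sum (kernel (w, t)) (crossing (w, t)) = odd_sum (kernel (w', t)) (crossing (w, t))"
    by (simp add: kernel)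
  also have "\<dots> = odd_sum (kernel (w', t)) (crossing (w', t))"
    by (intro odd_sum_cong refl cross(1)) (auto simp: kernel_def)
  finally have "crossing_invariant (w, t) = crossing_invariant (w', t)"
    by (simp add: crossing_invariant_def)
  then show ?case
    by (simp add: w_def w'_def)
next
  case (H3 x A B y C z u t)
  define w where "w = x @ A # B # y @ A # C # z @ B # C # u"
  define w' where "w' = x @ B # A # y @ C # A # z @ C # B # u"
  have w: "gauss_word w" "w = x @ A # B # y @ A # C # z @ B # C # u"
    "gauss_word w'" "w' = x @ B # A # y @ C # A # z @ C # B # u"
    using H3 by (simp_all add: w_def w'_def)
  have "kernel (w', t) = kernel (w, t)"
    using H3 by (intro kernel_cong H3_link_sum [OF w]) (auto simp: w_def w'_def)
  moreover have "odd_sum (kernel (w, t)) (crossing (w', t)) = odd_sum (kernel (w, t)) (crossing (w, t))"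
    using H3 by (intro odd_sum_cong refl H3_crossing [OF w]) (auto simp: kernel_def)
  ultimately have "crossing_invariant (w, t) = crossing_invariant (w', t)"
    by (simp add: crossing_invariant_def)
  then show ?case
    by (simp add: w_def w'_def)
qed

section \<open>Compatibility of the 0-covering with homotopy\<close>

text \<open>Images of single steps are only required to be equivalent, because the 0-covering may
  delete all letters displayed by a move.\<close>

lemma equivclp_homomorphic:
  assumes "equivclp r x y" "\<And>x y. r x y \<Longrightarrow> equivclp s (f x) (f y)"
  shows "equivclp s (f x) (f y)"
  using assms(1)
proof (induction rule: equivclp_induct)
  case (step y z)
  then show ?case
    by (metis assms(2) equivclp_sym equivclp_trans)
qed simp

lemma crossing_invariant_homotopic:
  assumes "(\<alpha>, \<beta>) \<in> homotopy"
  shows "crossing_invariant \<alpha> = crossing_invariant \<beta>"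
proof -
  have "equivclp move \<alpha> \<beta>"
    using assms by (simp add: homotopy_def)
  then show ?thesis
    by (induction rule: equivclp_induct) (auto dest: crossing_invariant_move)
qed

text \<open>This describes the coverings of both sides of a move by one predicate, which can then be
  distributed over the pieces of the two words.\<close>

lemma covering0_eq:
  assumes "\<And>X. X \<in> set w \<Longrightarrow> link_sum (w, t) X = link_sum (w', t') X"
  shows "nanoword_covering0 (w, t) = (filter (\<lambda>X. link_sum (w', t') X = 0) w, t)"
  using assms by (auto simp: nanoword_covering0_def intro: filter_cong)

lemma gauss_word_covering0:
  "gauss_word (fst \<alpha>) \<Longrightarrow> gauss_word (fst (nanoword_covering0 \<alpha>))"
  by (simp add: nanoword_covering0_def gauss_word_filter)

text \<open>The moves preserve n on common letters. Filtering therefore gives the same move if the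
  displayed letters survive, and otherwise an isomorphism or equal words.\<close>

lemma covering0_move:
  "move \<alpha> \<beta> \<Longrightarrow> equivclp move (nanoword_covering0 \<alpha>) (nanoword_covering0 \<beta>)"
proof (induction rule: move.induct)
  case (iso \<alpha> \<beta>)
  then have "move (nanoword_covering0 \<alpha>) (nanoword_covering0 \<beta>)"
    by (intro move.iso covering0_isomorphic gauss_word_covering0)
  then show ?case by (rule r_into_equivclp)
next
  case (shift A x y A' t' t)
  define w where "w = A # x @ A # y"
  define w' where "w' = x @ A # y @ [A]"
  define s where "s = t(A := t' A')"
  define v where "v = x @ [A'] @ y @ [A']"
  note relabel = shift_relabel [OF shift, folded s_def w'_def v_def]
  have w: "gauss_word w" "w = A # x @ A # y" "gauss_word w'" "w' = x @ A # y @ [A]"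
    using shift(1) relabel(1) by (simp_all add: w_def w'_def)
  have t: "s A \<noteq> t A" "\<And>X. X \<noteq> A \<Longrightarrow> s X = t X"
    using shift by (auto simp: s_def)
  have st: "s X = t X" if "X \<in> set x \<union> set y" for X
    using that relabel(2,3) by (intro t(2)) blast
  define P where "P = (\<lambda>X. link_sum (w, t) X = 0)"
  have cov: "nanoword_covering0 (w, t) = (filter P w, t)"
    "nanoword_covering0 (w', s) = (filter P w', s)"
    unfolding P_def using w(2,4) by (intro covering0_eq shift_link_sum [OF w, where t = t and t' = s, OF t]; auto)+
  have gauss: "gauss_word (filter P w)" "gauss_word (filter P w')"
    using w(1,3) by (blast intro: gauss_word_filter)+
  have "move (filter P w, t) (filter P w', s)"
  proof (cases "P A")
    case True
    have "move ([A] @ filter P x @ [A] @ filter P y, t) (filter P x @ [A] @ filter P y @ [A], s)"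
      using gauss True t(1) st by (intro move.shift) (auto simp: w(2,4))
    then show ?thesis using True by (simp add: w(2,4))
  next
    case False
    \<comment> \<open>The filtered words coincide, but the type maps still differ at the deleted
      letter \<open>A\<close>.\<close>
    have "isomorphic (filter P w, t) (filter P w', s)"
      unfolding isomorphic_def using False st
      by (intro exI [of _ id]) (auto simp: w(2,4))
    then show ?thesis
      using gauss by (intro move.iso) auto
  qed
  moreover have "move (nanoword_covering0 (w', s)) (nanoword_covering0 (v, t'))"
    using w(3) shift(2) relabel(4)
    by (intro move.iso covering0_isomorphic gauss_word_covering0) (simp_all add: v_def)
  ultimately have "equivclp move (nanoword_covering0 (w, t)) (nanoword_covering0 (v, t'))"
    unfolding cov by (blast intro: equivclp_trans r_into_equivclp)
  then show ?case
    by (simp add: w_def v_def)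
next
  case (H1 x A y t)
  define w where "w = x @ A # A # y"
  define w' where "w' = x @ y"
  have w: "gauss_word w" "w = x @ A # A # y" "w' = x @ y"
    using H1 by (simp_all add: w_def w'_def)
  note link = H1_link_sum [OF w, where t = t]
  define P where "P = (\<lambda>X. link_sum (w, t) X = 0)"
  have cov: "nanoword_covering0 (w, t) = (filter P w, t)"
    "nanoword_covering0 (w', t) = (filter P w', t)"
    unfolding P_def using link(1) by (intro covering0_eq; simp)+
  have "gauss_word (filter P w)" "gauss_word (filter P w')"
    using w(1) H1(2) by (simp_all add: w'_def gauss_word_filter del: filter_append)
  then have "move (filter P x @ [A, A] @ filter P y, t) (filter P x @ filter P y, t)"
    using link(2) by (intro move.H1) (simp_all add: w P_def)
  then have "move (filter P w, t) (filter P w', t)"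
    using link(2) by (simp add: w P_def)
  then have "equivclp move (nanoword_covering0 (w, t)) (nanoword_covering0 (w', t))"
    unfolding cov by (rule r_into_equivclp)
  then show ?case
    by (simp add: w_def w'_def)
next
  case (H2 x A B y z t)
  define w where "w = x @ A # B # y @ B # A # z"
  define w' where "w' = x @ y @ z"
  have w: "gauss_word w" "w = x @ A # B # y @ B # A # z" "w' = x @ y @ z" and "A \<noteq> B"
    using H2 by (auto simp: w_def w'_def)
  note link = H2_link_sum [OF w \<open>A \<noteq> B\<close> \<open>t A \<noteq> t B\<close>]
  define P where "P = (\<lambda>X. link_sum (w, t) X = 0)"
  have cov: "nanoword_covering0 (w, t) = (filter P w, t)"
    "nanoword_covering0 (w', t) = (filter P w', t)"
    unfolding P_def using link(1) by (intro covering0_eq; simp)+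
  have PAB: "P A \<longleftrightarrow> P B"
    using link(2) by (simp add: P_def)
  have gauss: "gauss_word (filter P w)" "gauss_word (filter P w')"
    using w(1) H2(2) by (simp_all add: w'_def gauss_word_filter del: filter_append)
  have "equivclp move (filter P w, t) (filter P w', t)"
  proof (cases "P A")
    case True
    have "move (filter P x @ [A, B] @ filter P y @ [B, A] @ filter P z, t)
        (filter P x @ filter P y @ filter P z, t)"
      using gauss True PAB H2 by (intro move.H2) (simp_all add: w)
    then show ?thesis
      using True PAB by (simp add: w r_into_equivclp)
  qed (use PAB in \<open>simp add: w\<close>)
  then have "equivclp move (nanoword_covering0 (w, t)) (nanoword_covering0 (w', t))"
    unfolding cov .
  then show ?case
    by (simp add: w_def w'_def)
next
  case (H3 x A B y C z u t)
  define w where "w = x @ A # B # y @ A # C # z @ B # C # u"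
  define w' where "w' = x @ B # A # y @ C # A # z @ C # B # u"
  have w: "gauss_word w" "w = x @ A # B # y @ A # C # z @ B # C # u"
    "gauss_word w'" "w' = x @ B # A # y @ C # A # z @ C # B # u"
    using H3 by (simp_all add: w_def w'_def)
  note link = H3_link_sum [OF w \<open>t A = t B\<close> \<open>t B = t C\<close>]
  define P where "P = (\<lambda>X. link_sum (w, t) X = 0)"
  have "set w' = set w" by (auto simp: w)
  then have cov: "nanoword_covering0 (w, t) = (filter P w, t)"
    "nanoword_covering0 (w', t) = (filter P w', t)"
    unfolding P_def using link(1) by (intro covering0_eq; simp)+
  have gauss: "gauss_word (filter P w)" "gauss_word (filter P w')"
    using w(1,3) by (blast intro: gauss_word_filter)+
  \<comment> \<open>By n(B) = n(A) + n(C), either all three letters survive or at most one does, and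
    a single letter is not affected by the swaps.\<close>
  consider "P A" "P B" "P C" | "filter P w = filter P w'"
    using link(2) by (cases "P A"; cases "P B"; cases "P C") (auto simp: w P_def)
  then have "equivclp move (filter P w, t) (filter P w', t)"
  proof cases
    case 1
    have "move (filter P x @ [A, B] @ filter P y @ [A, C] @ filter P z @ [B, C] @ filter P u, t)
        (filter P x @ [B, A] @ filter P y @ [C, A] @ filter P z @ [C, B] @ filter P u, t)"
      using gauss 1 H3 by (intro move.H3) (simp_all add: w)
    then show ?thesis
      using 1 by (simp add: w r_into_equivclp)
  qed simp
  then have "equivclp move (nanoword_covering0 (w, t)) (nanoword_covering0 (w', t))"
    unfolding cov .
  then show ?case
    by (simp add: w_def w'_def)
qed

text \<open>The covering of any representative is homotopic to that of \<alpha>, hence to \<alpha>,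
  so all members of the union in \<open>covering0\<close> are the same class.\<close>

lemma covering0_class:
  assumes "\<alpha> \<in> nanowords" "nanoword_covering0 \<alpha> = \<alpha>"
  shows "covering0 (homotopy `` {\<alpha>}) = homotopy `` {\<alpha>}"
proof -
  have "homotopy `` {nanoword_covering0 \<beta>} = homotopy `` {\<alpha>}" if "(\<alpha>, \<beta>) \<in> homotopy" for \<beta>
  proof -
    have "equivclp move \<alpha> (nanoword_covering0 \<beta>)" "nanoword_covering0 \<beta> \<in> nanowords"
      using that equivclp_homomorphic [of move \<alpha> \<beta> move nanoword_covering0] covering0_move assms
      by (auto simp: homotopy_def nanoword_covering0_in_nanowords)
    then have "(\<alpha>, nanoword_covering0 \<beta>) \<in> homotopy"
      using assms(1) by (simp add: homotopy_def)
    then show ?thesis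
      using equiv_class_eq [OF equiv_homotopy] by blast
  qed
  moreover have "(\<alpha>, \<alpha>) \<in> homotopy"
    using assms(1) equiv_homotopy by (auto simp: equiv_def refl_on_def)
  ultimately show ?thesis
    unfolding covering0_def by blast
qed

section \<open>Concatenation on disjoint alphabets\<close>

text \<open>Letters \<open>X\<close> of \<open>u\<close> and \<open>Y\<close> of \<open>v\<close>
  have the pair word XXYY, in which neither has an occurrence between those of the other.\<close>

lemma append_arcs:
  assumes "gauss_word u" "gauss_word v" "set u \<inter> set v = {}"
  shows "X \<in> set u \<Longrightarrow> Y \<in> set u \<Longrightarrow> arc1 (u @ v) X Y = arc1 u X Y \<and> arc2 (u @ v) X Y = arc2 u X Y"
    "X \<in> set v \<Longrightarrow> Y \<in> set v \<Longrightarrow> arc1 (u @ v) X Y = arc1 v X Y \<and> arc2 (u @ v) X Y = arc2 v X Y"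
    "X \<in> set u \<Longrightarrow> Y \<in> set v \<Longrightarrow> arc1 (u @ v) X Y = 0 \<and> arc2 (u @ v) X Y = 0"
    "X \<in> set v \<Longrightarrow> Y \<in> set u \<Longrightarrow> arc1 (u @ v) X Y = 0 \<and> arc2 (u @ v) X Y = 0"
proof -
  have none: "pair_word x X Y = []" if "X \<notin> set x" "Y \<notin> set x" for x :: "'a list" and X Y
    using that by (auto simp: pair_word_def filter_empty_conv)
  have two: "pair_word x X Y = [Y, Y]" if "gauss_word x" "X \<notin> set x" "Y \<in> set x"
    for x :: "'a list" and X Y
    using pair_word_replicate [OF that(2), of Y] gauss_word_count [OF that(1,3)]
    by (simp add: numeral_2_eq_2)
  have disj: "X \<in> set u \<Longrightarrow> X \<notin> set v" "X \<in> set v \<Longrightarrow> X \<notin> set u" for X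
    using assms(3) by blast+
  show "X \<in> set u \<Longrightarrow> Y \<in> set u \<Longrightarrow> arc1 (u @ v) X Y = arc1 u X Y \<and> arc2 (u @ v) X Y = arc2 u X Y"
    "X \<in> set v \<Longrightarrow> Y \<in> set v \<Longrightarrow> arc1 (u @ v) X Y = arc1 v X Y \<and> arc2 (u @ v) X Y = arc2 v X Y"
    by (simp_all add: arc1_def arc2_def pair_word_append none disj)
  have uv: "pair_word (u @ v) X Y = [X, X, Y, Y]" "X \<noteq> Y" if "X \<in> set u" "Y \<in> set v" for X Y
    using that disj two [OF assms(1), of Y X] two [OF assms(2), of X Y] pair_word_commute [of u X Y]
    by (auto simp: pair_word_append)
  show "X \<in> set u \<Longrightarrow> Y \<in> set v \<Longrightarrow> arc1 (u @ v) X Y = 0 \<and> arc2 (u @ v) X Y = 0"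
    using uv [of X Y] by (auto simp: arc1_def arc2_def)
  show "X \<in> set v \<Longrightarrow> Y \<in> set u \<Longrightarrow> arc1 (u @ v) X Y = 0 \<and> arc2 (u @ v) X Y = 0"
    using uv [of Y X] by (auto simp: arc1_def arc2_def pair_word_commute [of "u @ v" X Y])
qed

lemma append_link_sum:
  assumes "gauss_word u" "gauss_word v" "set u \<inter> set v = {}"
  shows "X \<in> set u \<Longrightarrow> link_sum (u @ v, t) X = link_sum (u, t) X"
    "X \<in> set v \<Longrightarrow> link_sum (u @ v, t) X = link_sum (v, t) X"
proof -
  note arcs = append_arcs [OF assms]
  have "2 * link_sum (u @ v, t) X = 2 * link_sum (u, t) X" if "X \<in> set u"
    using that arcs assms(3) by (simp add: double_link_sum sum.union_disjoint)
  then show "X \<in> set u \<Longrightarrow> link_sum (u @ v, t) X = link_sum (u, t) X" by simp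
  have "2 * link_sum (u @ v, t) X = 2 * link_sum (v, t) X" if "X \<in> set v"
    using that arcs assms(3) by (simp add: double_link_sum sum.union_disjoint)
  then show "X \<in> set v \<Longrightarrow> link_sum (u @ v, t) X = link_sum (v, t) X" by simp
qed

lemma append_crossing:
  assumes "gauss_word u" "gauss_word v" "set u \<inter> set v = {}"
  shows "X \<in> set u \<Longrightarrow> Y \<in> set u \<Longrightarrow> crossing (u @ v, t) X Y = crossing (u, t) X Y"
    "X \<in> set v \<Longrightarrow> Y \<in> set v \<Longrightarrow> crossing (u @ v, t) X Y = crossing (v, t) X Y"
    "X \<in> set u \<Longrightarrow> Y \<in> set v \<Longrightarrow> crossing (u @ v, t) X Y = 0"
  using append_arcs [OF assms] assms(3) by (simp_all add: crossing_def sum.union_disjoint)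

text \<open>The crossing matrix of the concatenation is block diagonal, so each row sum stays within
  its block and the outer sum splits.\<close>

lemma crossing_invariant_append:
  assumes "gauss_word u" "gauss_word v" "set u \<inter> set v = {}"
  shows "crossing_invariant (u @ v, t) = crossing_invariant (u, t) + crossing_invariant (v, t)"
proof -
  note cross = append_crossing [OF assms, where t = t]
  have kernel: "kernel (u @ v, t) = kernel (u, t) \<union> kernel (v, t)"
    using append_link_sum [OF assms] by (auto simp: kernel_def)
  have sub: "kernel (u, t) \<subseteq> set u" "kernel (v, t) \<subseteq> set v"
    by (auto simp: kernel_def)
  then have fin: "finite (kernel (u, t))" "finite (kernel (v, t))"
    "kernel (u, t) \<inter> kernel (v, t) = {}"
    using assms(3) by (auto intro: finite_subset)
  have vu: "crossing (u @ v, t) X Y = 0" if "X \<in> set v" "Y \<in> set u" for X Y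
    using cross(3) [OF that(2,1)] crossing_antisym [of "(u @ v, t)" X Y] by simp
  have rows: "(\<Sum>Y\<in>kernel (u @ v, t). crossing (u @ v, t) X Y ^ 3) =
      (\<Sum>Y\<in>kernel (u, t). crossing (u @ v, t) X Y ^ 3) +
      (\<Sum>Y\<in>kernel (v, t). crossing (u @ v, t) X Y ^ 3)" for X
    unfolding kernel using fin by (rule sum.union_disjoint)
  have "(\<Sum>Y\<in>kernel (u @ v, t). crossing (u @ v, t) X Y ^ 3) =
      (\<Sum>Y\<in>kernel (u, t). crossing (u, t) X Y ^ 3)" if "X \<in> kernel (u, t)" for X
  proof -
    have "(\<Sum>Y\<in>kernel (v, t). crossing (u @ v, t) X Y ^ 3) = 0"
      using that sub cross(3) by (intro sum.neutral) auto
    moreover have "(\<Sum>Y\<in>kernel (u, t). crossing (u @ v, t) X Y ^ 3) =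
        (\<Sum>Y\<in>kernel (u, t). crossing (u, t) X Y ^ 3)"
      using that sub by (intro sum.cong refl arg_cong [of _ _ "\<lambda>x. x ^ 3"] cross(1)) auto
    ultimately show ?thesis
      by (simp add: rows)
  qed
  moreover have "(\<Sum>Y\<in>kernel (u @ v, t). crossing (u @ v, t) X Y ^ 3) =
      (\<Sum>Y\<in>kernel (v, t). crossing (v, t) X Y ^ 3)" if "X \<in> kernel (v, t)" for X
  proof -
    have "(\<Sum>Y\<in>kernel (u, t). crossing (u @ v, t) X Y ^ 3) = 0"
      using that sub vu by (intro sum.neutral) auto
    moreover have "(\<Sum>Y\<in>kernel (v, t). crossing (u @ v, t) X Y ^ 3) =
        (\<Sum>Y\<in>kernel (v, t). crossing (v, t) X Y ^ 3)"
      using that sub by (intro sum.cong refl arg_cong [of _ _ "\<lambda>x. x ^ 3"] cross(2)) auto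
    ultimately show ?thesis
      by (simp add: rows)
  qed
  moreover have "odd_sum (kernel (u @ v, t)) (crossing (u @ v, t)) =
      (\<Sum>X\<in>kernel (u, t). (\<Sum>Y\<in>kernel (u @ v, t). crossing (u @ v, t) X Y ^ 3) ^ 3) +
      (\<Sum>X\<in>kernel (v, t). (\<Sum>Y\<in>kernel (u @ v, t). crossing (u @ v, t) X Y ^ 3) ^ 3)"
    unfolding odd_sum_def by (subst kernel) (rule sum.union_disjoint [OF fin])
  ultimately show ?thesis
    by (simp add: crossing_invariant_def odd_sum_def)
qed

section \<open>A nanoword with non-zero invariant, and its powers\<close>

text \<open>Found by a computer search.\<close>
definition base_word :: "nat list" where
  "base_word = [0, 1, 2, 0, 3, 2, 4, 5, 6, 4, 1, 7, 8, 6, 7, 3, 5, 8]"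

text \<open>Period 9 lets one type map serve all the copies in \<open>power_word\<close>.\<close>

definition base_type :: "nat \<Rightarrow> letter_type" where
  "base_type n = (if n mod 9 \<in> {1, 5, 7} then Type_b else Type_a)"

lemma gauss_base_word: "gauss_word base_word"
  by (simp add: gauss_word_def base_word_def)

lemma base_link_sum: "\<forall>X\<in>set base_word. link_sum (base_word, base_type) X = 0"
  by code_simp

lemma base_crossing_invariant: "crossing_invariant (base_word, base_type) \<noteq> 0"
proof -
  \<comment> \<open>With all nine letters in the kernel, the claim becomes an evaluation over an
    explicit set.\<close>
  have "kernel (base_word, base_type) = set base_word"
    using base_link_sum by (auto simp: kernel_def)
  moreover have "odd_sum (set base_word) (crossing (base_word, base_type)) \<noteq> 0"
    by code_simp
  ultimately show ?thesis
    by (simp add: crossing_invariant_def)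
qed

text \<open>The offset \<open>9 * k\<close> gives each copy its own nine letters, as additivity
  requires.\<close>

fun power_word :: "nat \<Rightarrow> nat list" where
  "power_word 0 = []"
| "power_word (Suc k) = power_word k @ map (\<lambda>i. i + 9 * k) base_word"

lemma power_word_letters: "set (power_word k) \<subseteq> {..<9 * k}"
proof (induction k)
  case (Suc k)
  have "set base_word \<subseteq> {..<9}"
    by (simp add: base_word_def)
  then show ?case
    using Suc by fastforce
qed simp

text \<open>Each new copy is isomorphic to \<open>base_word\<close> and disjoint from the earlier
  ones, so it keeps n = 0 and adds the same amount to the invariant.\<close>

lemma power_word:
  "gauss_word (power_word k) \<and> (\<forall>X\<in>set (power_word k). link_sum (power_word k, base_type) X = 0) \<and>
   crossing_invariant (power_word k, base_type) = int k * crossing_invariant (base_word, base_type)"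
proof (induction k)
  case 0
  show ?case
    by (simp add: gauss_word_def crossing_invariant_def odd_sum_def kernel_def)
next
  case (Suc k)
  define f where "f = (\<lambda>i. i + 9 * k)"
  have f: "inj_on f (set base_word)" "\<And>X. X \<in> set base_word \<Longrightarrow> base_type (f X) = base_type X"
    by (auto simp: f_def inj_on_def base_type_def)
  have "count_list (map f w) (f X) = count_list w X" for w X
    by (induction w) (auto simp: f_def)
  then have g: "gauss_word (map f base_word)"
    using gauss_base_word by (auto simp: gauss_word_def)
  have "set (power_word k) \<inter> set (map f base_word) = {}"
    using power_word_letters [of k] by (fastforce simp: f_def)
  note ap = Suc.IH [THEN conjunct1] g this
  have u: "gauss_word (power_word k @ map f base_word)"
    using ap by (fastforce simp: gauss_word_def count_list_append count_list_0_iff disjoint_iff)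
  have link: "\<forall>X\<in>set (map f base_word). link_sum (map f base_word, base_type) X = 0"
    using link_sum_isomorphic [where t = base_type, OF f] base_link_sum by auto
  have "isomorphic (base_word, base_type) (map f base_word, base_type)"
    using f by (auto simp: isomorphic_def)
  then have "crossing_invariant (map f base_word, base_type) = crossing_invariant (base_word, base_type)"
    by (rule crossing_invariant_isomorphic [symmetric])
  moreover have "power_word (Suc k) = power_word k @ map f base_word"
    by (simp add: f_def)
  ultimately show ?case
    using u link Suc.IH append_link_sum [OF ap, of _ base_type]
      crossing_invariant_append [OF ap, of base_type]
    by (auto simp: algebra_simps simp del: power_word.simps)
qed

theorem theorem7p5: "infinite {\<Gamma> \<in> virtual_strings. covering0 \<Gamma> = \<Gamma>}"
proof -
  define \<alpha> where "\<alpha> k = (power_word k, base_type)" for k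
  have nanoword: "\<alpha> k \<in> nanowords" for k
    using power_word by (simp add: \<alpha>_def nanowords_def)
  have "nanoword_covering0 (\<alpha> k) = \<alpha> k" for k
    using power_word [of k] by (auto simp: \<alpha>_def nanoword_covering0_def)
  then have "homotopy `` {\<alpha> k} \<in> {\<Gamma> \<in> virtual_strings. covering0 \<Gamma> = \<Gamma>}" for k
    using nanoword covering0_class by (auto simp: virtual_strings_def intro: quotientI)
  \<comment> \<open>The invariant of the k-th power is k times a non-zero constant, so it separates
    the classes.\<close>
  moreover have "inj (\<lambda>k. homotopy `` {\<alpha> k})"
  proof (rule injI)
    fix j k assume "homotopy `` {\<alpha> j} = homotopy `` {\<alpha> k}"
    then have "(\<alpha> j, \<alpha> k) \<in> homotopy"
      using nanoword by (intro eq_equiv_class [OF _ equiv_homotopy])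
    then have "crossing_invariant (\<alpha> j) = crossing_invariant (\<alpha> k)"
      by (rule crossing_invariant_homotopic)
    then show "j = k"
      using power_word base_crossing_invariant by (simp add: \<alpha>_def)
  qed
  ultimately show ?thesis
    unfolding infinite_iff_countable_subset by blast
qed

end
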